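(* In terms of the tangent and secant numbers of order $k$, $T(n,k)$ and $S(n,k)$, for every integer $n\ge 0$ and every real $x$ (with $x\neq 0$ in (c) and (d)), we have: (a) $\displaystyle\frac{d^{n}}{dx^{n}}\tanh(x)=(-1)^{\frac{n-1}{2}}\,T(n,1)+\sum_{k=1}^{n+1} \frac{(-1)^{\frac{n+k-1}{2}}}{k}\,T(n+1,k)\tanh^k(x)$; (b) $\displaystyle\frac{d^{n}}{dx^{n}}\operatorname{sech}(x)= \operatorname{sech}(x)\sum_{k=0}^{n}(-1)^{\frac{n+k}{2}}\, S(n,k)\tanh^k(x)$; (c) $\displaystyle\frac{d^{n}}{dx^{n}}\coth(x)= (-1)^{\frac{n-1}{2}}\, T(n,1) +\sum_{k=1}^{n+1} \frac{(-1)^{\frac{n+k-1}{2}}}{k}\,T(n+1,k)\coth^k(x)$; (d) $\displaystyle\frac{d^{n}}{dx^{n}}\operatorname{csch}(x)= \operatorname{csch}(x)\sum_{k=0}^{n}(-1)^{\frac{n+k}{2}}\, S(n,k)\coth^k(x)$.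
   Context: The tangent numbers of order $k$, $T(n,k)$, are defined for integers $k\ge 1$ by the power series expansion at $t=0$ $$\tan^{k}(t)=\sum_{n = k}^{\infty} T(n,k)\,\frac{t^n}{n!},$$ and the secant numbers of order $k$, $S(n,k)$, are defined for integers $k\ge 0$ by $$\sec(t) \tan^{k}(t)=\sum_{n = k}^{\infty} S(n,k)\,\frac{t^n}{n!}.$$ By convention $T(n,k)=0$ and $S(n,k)=0$ for $0\le n<k$ (in particular $T(0,1)=0$). By parity, $T(n,k)$ and $S(n,k)$ also vanish unless $n$ and $k$ have the same parity; hence every term in the formulas whose power of $-1$ has a non-integer exponent has a zero coefficient, and is understood to be $0$ (equivalently, $(-1)^{m/2}$ may be read as $\imath^{m}$, $\imath=\sqrt{-1}$). Here $\operatorname{sech}=1/\cosh$, $\coth=\cosh/\sinh$, $\operatorname{csch}=1/\sinh$. *)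

theory Defs
  imports "HOL-Analysis.Analysis"
begin

definition sech :: "real \<Rightarrow> real" where
  "sech x = 1 / cosh x"

definition coth :: "real \<Rightarrow> real" where
  "coth x = cosh x / sinh x"

definition csch :: "real \<Rightarrow> real" where
  "csch x = 1 / sinh x"

text \<open>
  Tangent and secant numbers of order \<open>k\<close>: the coefficients of \<open>t ^ n / n!\<close> in the
  power series expansions of \<open>tan t ^ k\<close> and \<open>sec t * tan t ^ k\<close> at \<open>t = 0\<close>; see
  the expansion lemmas below.
\<close>

definition tangent_number :: "nat \<Rightarrow> nat \<Rightarrow> real" where
  "tangent_number n k = fact n * fps_nth (fps_tan 1 ^ k) n"

definition secant_number :: "nat \<Rightarrow> nat \<Rightarrow> real" where
  "secant_number n k = fact n * fps_nth (inverse (fps_cos 1) * fps_tan 1 ^ k) n"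

lemma has_fps_expansion_tan_power:
  "(\<lambda>t::real. tan t ^ k) has_fps_expansion fps_tan 1 ^ k"
proof (induction k)
  case 0
  show ?case by simp
next
  case (Suc k)
  show ?case
    using has_fps_expansion_mult[OF has_fps_expansion_tan' Suc.IH] by simp
qed

lemma tangent_number_expansion:
  "(\<lambda>t::real. tan t ^ k) has_fps_expansion Abs_fps (\<lambda>n. tangent_number n k / fact n)"
proof -
  have "Abs_fps (\<lambda>n. tangent_number n k / fact n) = fps_tan 1 ^ k"
    by (simp add: fps_eq_iff tangent_number_def)
  then show ?thesis using has_fps_expansion_tan_power by simp
qed

lemma secant_number_expansion:
  "(\<lambda>t::real. 1 / cos t * tan t ^ k)
     has_fps_expansion Abs_fps (\<lambda>n. secant_number n k / fact n)"
proof -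
  have "Abs_fps (\<lambda>n. secant_number n k / fact n) = inverse (fps_cos 1) * fps_tan 1 ^ k"
    by (simp add: fps_eq_iff secant_number_def)
  moreover have "(\<lambda>t::real. inverse (cos t) * tan t ^ k)
      has_fps_expansion inverse (fps_cos 1) * fps_tan 1 ^ k"
    by (intro has_fps_expansion_mult has_fps_expansion_inverse has_fps_expansion_cos'
        has_fps_expansion_tan_power) simp
  ultimately show ?thesis by (simp add: inverse_eq_divide)
qed

lemma fps_tan_nth_0: "fps_nth (fps_tan (1::real)) 0 = 0"
  by (simp add: fps_tan_def fps_divide_unit)

lemma tangent_number_eq_0: "n < k \<Longrightarrow> tangent_number n k = 0"
  by (simp add: tangent_number_def startsby_zero_power_prefix fps_tan_nth_0)

lemma secant_number_eq_0: "n < k \<Longrightarrow> secant_number n k = 0"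
  by (simp add: secant_number_def fps_mult_nth startsby_zero_power_prefix fps_tan_nth_0)

text \<open>
  For integers \<open>m\<close>, the sign \<open>(-1) ^ (m / 2)\<close> is read as \<open>\<i> powi m\<close>; this is the usual
  integer power of \<open>-1\<close> when \<open>m\<close> is even.
\<close>

lemma i_powi_double: "\<i> powi (2 * j) = (-1) powi j"
  by (simp add: power_int_mult)

end

theory Submission
  imports Defs
begin

text \<open>
  All four formulas are the same computation, because \<open>tanh\<close> and \<open>coth\<close> both solve the
  Riccati equation \<open>y' = 1 - y\<^sup>2\<close>, and \<open>sech\<close> and \<open>csch\<close> solve \<open>s' = - s y\<close> over them.
  Put \<open>w = \<i> y\<close>. Then \<open>w' = \<i> (1 + w\<^sup>2)\<close> and \<open>s' = \<i> s w\<close>, which up to the factor \<open>\<i>\<close>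
  are the equations of \<open>tan\<close> and \<open>sec\<close>. Consequently, differentiating a polynomial in \<open>w\<close>,
  or \<open>s\<close> times such a polynomial, acts on its coefficients by the transpose of the
  recurrences that \<open>T\<close> and \<open>S\<close> inherit from differentiating \<open>tan ^ k\<close> and \<open>sec * tan ^ k\<close>:

    \<open>T (n + 1) k = k (T n (k - 1) + T n (k + 1))\<close>,

    \<open>S (n + 1) k = k S n (k - 1) + (k + 1) S n (k + 1)\<close>.

  For \<open>S\<close> the transposed recurrence is the recurrence itself; for \<open>T\<close> it becomes so after
  dividing \<open>T n k\<close> by \<open>k\<close>, which accounts for the \<open>1 / k\<close> in the formulas, and for the
  separate constant term, as the coefficient at \<open>k = 0\<close> cannot be obtained in this way.

  In terms of \<open>w\<close> the signs disappear: \<open>\<i> powi (n + k) * y ^ k = \<i> ^ n * w ^ k\<close>. Lemmas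
  \<open>tangent_tower\<close> and \<open>secant_tower\<close> show that the right-hand sides, written in this way,
  are successive derivatives of each other. Their terms are complex, but a complex
  derivative of a function with real values on an open set is real
  (\<open>iterated_deriv_of_real_eq\<close>); hence the tower consists of the real derivatives of \<open>y\<close> or \<open>s\<close>.
\<close>

section \<open>Recurrences for the tangent and secant numbers\<close>

lemma fps_deriv_tan: "fps_deriv (fps_tan (1::real)) = 1 + fps_tan 1 ^ 2"
proof -
  let ?s = "fps_sin (1::real)" and ?c = "fps_cos (1::real)"
  have c: "inverse ?c * ?c = 1"
    by (intro inverse_mult_eq_1) simp
  have tan: "fps_tan 1 = ?s * inverse ?c"
    by (simp add: fps_tan_def fps_divide_unit)
  have "fps_deriv (fps_tan 1) = inverse ?c * ?c + ?s\<^sup>2 * inverse ?c ^ 2"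
    by (simp add: tan fps_sin_deriv fps_cos_deriv fps_inverse_deriv power2_eq_square mult_ac
        flip: fps_const_neg)
  then show ?thesis
    by (simp add: c tan power_mult_distrib)
qed

lemma fps_deriv_sec:
  "fps_deriv (inverse (fps_cos (1::real))) = inverse (fps_cos 1) * fps_tan 1"
  by (simp add: fps_tan_def fps_divide_unit fps_cos_deriv fps_inverse_deriv
      power2_eq_square mult_ac flip: fps_const_neg)

text \<open>
  For exponential coefficients, raising the index by one means differentiating the series.
  The recurrences below are read off from the derivatives of \<open>tan ^ k\<close> and \<open>sec * tan ^ k\<close>.
\<close>

lemma fact_Suc_mult_fps_nth:
  fixes f :: "'a::{comm_ring_1,semiring_char_0} fps"
  shows "fact (Suc n) * fps_nth f (Suc n) = fact n * fps_nth (fps_deriv f) n"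
  by (simp add: algebra_simps)

lemma tangent_number_Suc_0: "tangent_number (Suc n) 0 = 0"
  by (simp add: tangent_number_def)

lemma tangent_number_Suc_Suc:
  "tangent_number (Suc n) (Suc k)
     = real (Suc k) * (tangent_number n k + tangent_number n (Suc (Suc k)))"
proof -
  have "fps_deriv (fps_tan (1::real) ^ Suc k)
      = fps_const (real (Suc k)) * (fps_tan 1 ^ k + fps_tan 1 ^ Suc (Suc k))"
    unfolding fps_deriv_power fps_deriv_tan
    by (simp add: algebra_simps power2_eq_square del: of_nat_Suc)
  then show ?thesis
    unfolding tangent_number_def fact_Suc_mult_fps_nth
    by (simp only: fps_mult_left_const_nth fps_add_nth distrib_left mult_ac)
qed

lemma secant_number_Suc_0: "secant_number (Suc n) 0 = secant_number n 1"
  unfolding secant_number_def fact_Suc_mult_fps_nth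
  by (simp only: power_0 mult_1_right fps_deriv_sec power_one_right)

lemma secant_number_Suc_Suc:
  "secant_number (Suc n) (Suc k)
     = real (Suc k) * secant_number n k + real (Suc (Suc k)) * secant_number n (Suc (Suc k))"
proof -
  let ?u = "inverse (fps_cos (1::real))" and ?t = "fps_tan (1::real)"
  have c: "fps_const (real (Suc (Suc k))) = 1 + fps_const (real (Suc k))"
    by simp
  have deriv: "fps_deriv (?u * ?t ^ Suc k)
      = fps_const (real (Suc k)) * (?u * ?t ^ k)
        + fps_const (real (Suc (Suc k))) * (?u * ?t ^ Suc (Suc k))"
    unfolding fps_deriv_mult fps_deriv_power fps_deriv_tan fps_deriv_sec c
    by (simp add: algebra_simps power2_eq_square del: of_nat_Suc)
  show ?thesis
    unfolding secant_number_def fact_Suc_mult_fps_nth deriv fps_mult_left_const_nth fps_add_nth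
    by (simp only: distrib_left mult.left_commute)
qed

section \<open>Derivatives of real functions with complex expressions\<close>

text \<open>
  The induction passes from complex to real derivatives: on the open set \<open>S\<close> the function
  \<open>F n\<close> agrees with a real-valued one, so the imaginary part of its derivative is the derivative
  of the zero function.
\<close>

lemma iterated_deriv_of_real_eq:
  fixes f :: "real \<Rightarrow> real" and F :: "nat \<Rightarrow> real \<Rightarrow> complex"
  assumes S: "open S"
    and F0: "\<And>t. t \<in> S \<Longrightarrow> complex_of_real (f t) = F 0 t"
    and FS: "\<And>n t. t \<in> S \<Longrightarrow> (F n has_vector_derivative F (Suc n) t) (at t)"
    and "t \<in> S"
  shows "complex_of_real ((deriv ^^ n) f t) = F n t"
  using \<open>t \<in> S\<close>
proof (induction n arbitrary: t)
  case 0
  then show ?case by (simp add: F0)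
next
  case (Suc n)
  let ?g = "(deriv ^^ n) f"
  have "((\<lambda>u. complex_of_real (?g u)) has_vector_derivative F (Suc n) t) (at t)"
    using has_vector_derivative_transform_within_open[OF FS[OF Suc.prems] S Suc.prems] Suc.IH
    by simp
  then have d: "(?g has_real_derivative Re (F (Suc n) t)) (at t)"
    and i: "((\<lambda>u. 0 :: real) has_real_derivative Im (F (Suc n) t)) (at t)"
    by (auto simp: has_vector_derivative_complex_iff)
  have "Im (F (Suc n) t) = 0"
    using DERIV_unique[OF i DERIV_const] .
  with DERIV_imp_deriv[OF d] show ?case
    by (simp add: complex_eq_iff)
qed

section \<open>Polynomials in a solution of the tangent equation\<close>

text \<open>
  Differentiating \<open>T (n + 1) k / k * w ^ k\<close> cancels the denominator and leaves
  \<open>\<i> T (n + 1) k (w ^ (k - 1) + w ^ (k + 1))\<close>. Collecting powers of \<open>w\<close>, the coefficient of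
  \<open>w ^ k\<close> is \<open>T (n + 1) (k + 1) + T (n + 1) (k - 1) = T (n + 2) k / k\<close> for \<open>k > 0\<close>, while
  the constant term is \<open>T (n + 1) 1\<close>.
\<close>

lemma tangent_tower:
  fixes w :: "real \<Rightarrow> complex"
  defines "F \<equiv> \<lambda>n t. \<i> powi (int n - 1) * (of_real (tangent_number n 1)
      + (\<Sum>k = 1..n + 1. of_real (tangent_number (n + 1) k) / of_nat k * w t ^ k))"
  assumes w: "(w has_vector_derivative \<i> * (1 + w t ^ 2)) (at t)"
  shows "(F n has_vector_derivative F (Suc n) t) (at t)"
proof -
  let ?T = "\<lambda>k. complex_of_real (tangent_number (Suc n) k)" and ?w = "w t"
  have pow: "((\<lambda>t. w t ^ k) has_vector_derivative of_nat k * w t ^ (k - 1) * (\<i> * (1 + w t ^ 2))) (at t)"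
    for k
    using field_vector_diff_chain_at[OF w DERIV_power[OF DERIV_ident]]
    by (simp add: o_def mult_ac)
  have "(F n has_vector_derivative \<i> powi (int n - 1) * (0 + (\<Sum>k = 1..n + 1.
      ?T k / of_nat k * (of_nat k * ?w ^ (k - 1) * (\<i> * (1 + ?w\<^sup>2)))))) (at t)"
    unfolding F_def Suc_eq_plus1
    by (intro has_vector_derivative_mult_right has_vector_derivative_add
        has_vector_derivative_const has_vector_derivative_sum pow)
  also have "(\<Sum>k = 1..n + 1. ?T k / of_nat k * (of_nat k * ?w ^ (k - 1) * (\<i> * (1 + ?w\<^sup>2))))
      = \<i> * (\<Sum>k = 1..n + 1. ?T k * (?w ^ (k - 1) + ?w ^ (k + 1)))"
    unfolding sum_distrib_left
    by (intro sum.cong refl) (auto simp: Suc_le_eq field_simps power2_eq_square dest!: gr0_implies_Suc)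
  also have "(\<Sum>k = 1..n + 1. ?T k * (?w ^ (k - 1) + ?w ^ (k + 1)))
      = (\<Sum>k\<le>n. ?T (Suc k) * ?w ^ k) + (\<Sum>k\<le>Suc n. ?T k * ?w ^ Suc k)"
    unfolding One_nat_def add_Suc_right add_0_right sum.atLeast1_atMost_eq distrib_left sum.distrib
      sum.atMost_shift[of "\<lambda>k. ?T k * ?w ^ Suc k"]
    by (simp add: tangent_number_Suc_0 lessThan_Suc_atMost)
  \<comment> \<open>The right-hand side includes terms with \<open>T (n + 1) (n + 2)\<close> and \<open>T (n + 1) (n + 3)\<close>,
    which are zero, so that both sums get the same range.\<close>
  also have "\<dots> = ?T 1 + (\<Sum>k\<le>Suc n. (?T (Suc (Suc k)) + ?T k) * ?w ^ Suc k)"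
    unfolding sum.atMost_shift[of "\<lambda>k. ?T (Suc k) * ?w ^ k"] distrib_right sum.distrib
    by (simp add: tangent_number_eq_0 flip: lessThan_Suc_atMost)
  also have "(\<Sum>k\<le>Suc n. (?T (Suc (Suc k)) + ?T k) * ?w ^ Suc k)
      = (\<Sum>k = 1..Suc n + 1. of_real (tangent_number (Suc n + 1) k) / of_nat k * ?w ^ k)"
    unfolding One_nat_def add_Suc_right add_0_right sum.atLeast1_atMost_eq lessThan_Suc_atMost
    by (intro sum.cong refl) (simp add: tangent_number_Suc_Suc[of "Suc n"] add.commute del: of_nat_Suc)
  finally show ?thesis
    by (simp add: F_def power_int_diff field_simps power_int_add)
qed

text \<open>
  The derivative of \<open>s w ^ k\<close> is \<open>\<i> s (k w ^ (k - 1) + (k + 1) w ^ (k + 1))\<close>: the factor \<open>k + 1\<close>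
  consists of \<open>1\<close> from \<open>s' = \<i> s w\<close> and \<open>k\<close> from the derivative of \<open>w ^ k\<close>. Collecting powers
  of \<open>w\<close> in the sum gives the right-hand side of the recurrence for \<open>S\<close>.
\<close>

lemma secant_tower:
  fixes w s :: "real \<Rightarrow> complex"
  defines "F \<equiv> \<lambda>n t. \<i> powi int n * (s t *
      (\<Sum>k = 0..n. of_real (secant_number n k) * w t ^ k))"
  assumes w: "(w has_vector_derivative \<i> * (1 + w t ^ 2)) (at t)"
    and s: "(s has_vector_derivative \<i> * (s t * w t)) (at t)"
  shows "(F n has_vector_derivative F (Suc n) t) (at t)"
proof -
  let ?S = "\<lambda>k. complex_of_real (secant_number n k)" and ?w = "w t"
  have pow: "((\<lambda>t. w t ^ k) has_vector_derivative of_nat k * w t ^ (k - 1) * (\<i> * (1 + w t ^ 2))) (at t)"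
    for k
    using field_vector_diff_chain_at[OF w DERIV_power[OF DERIV_ident]]
    by (simp add: o_def mult_ac)
  have "(F n has_vector_derivative \<i> powi int n * (s t * (\<Sum>k = 0..n.
      ?S k * (of_nat k * ?w ^ (k - 1) * (\<i> * (1 + ?w\<^sup>2)))) + \<i> * (s t * ?w) * (\<Sum>k = 0..n. ?S k * ?w ^ k))) (at t)"
    unfolding F_def
    by (intro has_vector_derivative_mult_right has_vector_derivative_mult
        has_vector_derivative_sum pow s)
  also have "s t * (\<Sum>k = 0..n. ?S k * (of_nat k * ?w ^ (k - 1) * (\<i> * (1 + ?w\<^sup>2)))) + \<i> * (s t * ?w) * (\<Sum>k = 0..n. ?S k * ?w ^ k)
     = \<i> * s t * (\<Sum>k = 0..n. of_nat k * ?S k * ?w ^ (k - 1) + of_nat (Suc k) * ?S k * ?w ^ Suc k)"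
    unfolding sum_distrib_left sum.distrib[symmetric]
  proof (intro sum.cong refl)
    fix k
    show "s t * (?S k * (of_nat k * ?w ^ (k - 1) * (\<i> * (1 + ?w\<^sup>2)))) + \<i> * (s t * ?w) * (?S k * ?w ^ k)
        = \<i> * s t * (of_nat k * ?S k * ?w ^ (k - 1) + of_nat (Suc k) * ?S k * ?w ^ Suc k)"
      by (cases k) (simp_all add: algebra_simps power2_eq_square)
  qed
  also have "(\<Sum>k = 0..n. of_nat k * ?S k * ?w ^ (k - 1) + of_nat (Suc k) * ?S k * ?w ^ Suc k)
     = (\<Sum>k\<le>n. of_nat k * ?S k * ?w ^ (k - 1)) + (\<Sum>k\<le>n. of_nat (Suc k) * ?S k * ?w ^ Suc k)"
    by (simp add: sum.distrib atMost_atLeast0)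
  also have "\<dots> = ?S 1 + (\<Sum>k\<le>n. (of_nat (Suc (Suc k)) * ?S (Suc (Suc k)) + of_nat (Suc k) * ?S k) * ?w ^ Suc k)"
  proof -
    \<comment> \<open>Again the upper limit is raised by two, where \<open>S n (n + 1) = S n (n + 2) = 0\<close>.\<close>
    have "(\<Sum>k\<le>n. of_nat k * ?S k * ?w ^ (k - 1))
        = (\<Sum>k\<le>Suc n. of_nat (Suc k) * ?S (Suc k) * ?w ^ k)"
      unfolding sum.atMost_shift[of "\<lambda>k. of_nat k * ?S k * ?w ^ (k - 1)"]
      by (simp add: secant_number_eq_0 flip: lessThan_Suc_atMost)
    then show ?thesis
      unfolding sum.atMost_Suc_shift distrib_right sum.distrib by simp
  qed
  also have "\<dots> = (\<Sum>k = 0..Suc n. of_real (secant_number (Suc n) k) * ?w ^ k)"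
    unfolding atLeast0AtMost sum.atMost_Suc_shift
    by (simp add: secant_number_Suc_0 secant_number_Suc_Suc add.commute)
  finally show ?thesis
    by (simp add: F_def power_int_add mult_ac)
qed

section \<open>Solutions of the Riccati equation and the hyperbolic functions\<close>

text \<open>
  The next two lemmas are the common form of (a), (c) and of (b), (d). Keeping the domain \<open>S\<close>
  general allows \<open>tanh\<close> on the whole line as well as \<open>coth\<close> away from its pole.
\<close>

lemma iterated_deriv_riccati:
  fixes y :: "real \<Rightarrow> real"
  assumes S: "open S" "x \<in> S"
    and y: "\<And>t. t \<in> S \<Longrightarrow> (y has_real_derivative 1 - y t ^ 2) (at t)"
  shows "complex_of_real ((deriv ^^ n) y x) =
           \<i> powi (int n - 1) * complex_of_real (tangent_number n 1) +
           (\<Sum>k = 1..n + 1. \<i> powi (int n + int k - 1) / of_nat k *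
              complex_of_real (tangent_number (n + 1) k) * complex_of_real (y x) ^ k)"
proof -
  define w where "w t = \<i> * complex_of_real (y t)" for t
  have w: "(w has_vector_derivative \<i> * (1 + w t ^ 2)) (at t)" if "t \<in> S" for t
    using y[OF that] unfolding w_def
    by (auto simp: has_vector_derivative_complex_iff power2_eq_square)
  let ?F = "\<lambda>n t. \<i> powi (int n - 1) * (of_real (tangent_number n 1)
      + (\<Sum>k = 1..n + 1. of_real (tangent_number (n + 1) k) / of_nat k * w t ^ k))"
  have "complex_of_real ((deriv ^^ n) y x) = \<i> powi (int n - 1) * (of_real (tangent_number n 1)
      + (\<Sum>k = 1..n + 1. of_real (tangent_number (n + 1) k) / of_nat k * w x ^ k))"
    by (rule iterated_deriv_of_real_eq[where F = ?F, OF S(1) _ tangent_tower[OF w] S(2)])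
      (simp_all add: w_def tangent_number_def[of 0 0] tangent_number_eq_0 tangent_number_Suc_Suc power_int_minus)
  also have "\<dots> = \<i> powi (int n - 1) * complex_of_real (tangent_number n 1) +
           (\<Sum>k = 1..n + 1. \<i> powi (int n + int k - 1) / of_nat k *
              complex_of_real (tangent_number (n + 1) k) * complex_of_real (y x) ^ k)"
    unfolding distrib_left sum_distrib_left
    by (intro arg_cong2[where f = "(+)"] refl sum.cong)
      (simp_all add: w_def power_int_diff power_int_add power_mult_distrib)
  finally show ?thesis .
qed

lemma iterated_deriv_log_deriv_riccati:
  fixes y s :: "real \<Rightarrow> real"
  assumes S: "open S" "x \<in> S"
    and y: "\<And>t. t \<in> S \<Longrightarrow> (y has_real_derivative 1 - y t ^ 2) (at t)"
    and s: "\<And>t. t \<in> S \<Longrightarrow> (s has_real_derivative - (s t * y t)) (at t)"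
  shows "complex_of_real ((deriv ^^ n) s x) =
           complex_of_real (s x) *
           (\<Sum>k = 0..n. \<i> powi (int n + int k) *
              complex_of_real (secant_number n k) * complex_of_real (y x) ^ k)"
proof -
  define w where "w t = \<i> * complex_of_real (y t)" for t
  have w: "(w has_vector_derivative \<i> * (1 + w t ^ 2)) (at t)" if "t \<in> S" for t
    using y[OF that] unfolding w_def
    by (auto simp: has_vector_derivative_complex_iff power2_eq_square)
  have s': "((\<lambda>t. complex_of_real (s t)) has_vector_derivative \<i> * (of_real (s t) * w t)) (at t)"
    if "t \<in> S" for t
    using s[OF that] unfolding w_def
    by (auto simp: has_vector_derivative_complex_iff)
  let ?F = "\<lambda>n t. \<i> powi int n * (of_real (s t) *
      (\<Sum>k = 0..n. of_real (secant_number n k) * w t ^ k))"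
  have "complex_of_real ((deriv ^^ n) s x) = \<i> powi int n * (of_real (s x) *
      (\<Sum>k = 0..n. of_real (secant_number n k) * w x ^ k))"
    by (rule iterated_deriv_of_real_eq[where F = ?F, OF S(1) _ secant_tower[OF w s'] S(2)])
      (simp_all add: secant_number_def)
  also have "\<dots> = complex_of_real (s x) * (\<Sum>k = 0..n. \<i> powi (int n + int k) *
              complex_of_real (secant_number n k) * complex_of_real (y x) ^ k)"
    unfolding sum_distrib_left
    by (intro sum.cong refl) (simp add: w_def power_int_add power_mult_distrib)
  finally show ?thesis .
qed

lemma DERIV_tanh_real: "(tanh has_real_derivative 1 - tanh t ^ 2) (at t)" for t :: real
  by (auto intro!: derivative_eq_intros)

lemma DERIV_sech: "(sech has_real_derivative - (sech t * tanh t)) (at t)"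
  unfolding sech_def[abs_def]
  by (auto intro!: derivative_eq_intros simp: tanh_def power2_eq_square)

lemma DERIV_coth: "t \<noteq> 0 \<Longrightarrow> (coth has_real_derivative 1 - coth t ^ 2) (at t)"
  unfolding coth_def[abs_def]
  by (auto intro!: derivative_eq_intros simp: field_simps power2_eq_square)

lemma DERIV_csch: "t \<noteq> 0 \<Longrightarrow> (csch has_real_derivative - (csch t * coth t)) (at t)"
  unfolding csch_def[abs_def] coth_def
  by (auto intro!: derivative_eq_intros simp: power2_eq_square)

theorem corollary2:
  fixes n :: nat and x :: real
  shows "complex_of_real ((deriv ^^ n) tanh x) =
           \<i> powi (int n - 1) * complex_of_real (tangent_number n 1) +
           (\<Sum>k = 1..n + 1. \<i> powi (int n + int k - 1) / of_nat k *
              complex_of_real (tangent_number (n + 1) k) * complex_of_real (tanh x) ^ k)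
       \<and> complex_of_real ((deriv ^^ n) sech x) =
           complex_of_real (sech x) *
           (\<Sum>k = 0..n. \<i> powi (int n + int k) *
              complex_of_real (secant_number n k) * complex_of_real (tanh x) ^ k)
       \<and> (x \<noteq> 0 \<longrightarrow> complex_of_real ((deriv ^^ n) coth x) =
           \<i> powi (int n - 1) * complex_of_real (tangent_number n 1) +
           (\<Sum>k = 1..n + 1. \<i> powi (int n + int k - 1) / of_nat k *
              complex_of_real (tangent_number (n + 1) k) * complex_of_real (coth x) ^ k))
       \<and> (x \<noteq> 0 \<longrightarrow> complex_of_real ((deriv ^^ n) csch x) =
           complex_of_real (csch x) *
           (\<Sum>k = 0..n. \<i> powi (int n + int k) *
              complex_of_real (secant_number n k) * complex_of_real (coth x) ^ k))"
proof (intro conjI impI)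
  have U: "open (UNIV :: real set)" "x \<in> UNIV"
    by simp_all
  show "complex_of_real ((deriv ^^ n) tanh x) =
           \<i> powi (int n - 1) * complex_of_real (tangent_number n 1) +
           (\<Sum>k = 1..n + 1. \<i> powi (int n + int k - 1) / of_nat k *
              complex_of_real (tangent_number (n + 1) k) * complex_of_real (tanh x) ^ k)"
    by (rule iterated_deriv_riccati[OF U DERIV_tanh_real])
  show "complex_of_real ((deriv ^^ n) sech x) =
           complex_of_real (sech x) *
           (\<Sum>k = 0..n. \<i> powi (int n + int k) *
              complex_of_real (secant_number n k) * complex_of_real (tanh x) ^ k)"
    by (rule iterated_deriv_log_deriv_riccati[OF U DERIV_tanh_real DERIV_sech])
next
  assume "x \<noteq> 0"
  then have U: "open (- {0 :: real})" "x \<in> - {0}"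
    by auto
  show "complex_of_real ((deriv ^^ n) coth x) =
           \<i> powi (int n - 1) * complex_of_real (tangent_number n 1) +
           (\<Sum>k = 1..n + 1. \<i> powi (int n + int k - 1) / of_nat k *
              complex_of_real (tangent_number (n + 1) k) * complex_of_real (coth x) ^ k)"
    by (rule iterated_deriv_riccati[OF U DERIV_coth]) simp
next
  assume "x \<noteq> 0"
  then have U: "open (- {0 :: real})" "x \<in> - {0}"
    by auto
  show "complex_of_real ((deriv ^^ n) csch x) =
           complex_of_real (csch x) *
           (\<Sum>k = 0..n. \<i> powi (int n + int k) *
              complex_of_real (secant_number n k) * complex_of_real (coth x) ^ k)"
    by (rule iterated_deriv_log_deriv_riccati[OF U DERIV_coth DERIV_csch]) simp_all
qed

end
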